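(* Let $M=\begin{pmatrix}\gamma_1&0\\0&\gamma_2\end{pmatrix}$, $\gamma_1,\gamma_2\in\mathbb Z$, be a matrix dilation and $n\in\mathbb N$. Then there exists a mask $m_0$ that is axial symmetric with respect to the center $c=(1/2,1/2)$ and has sum rule of order $n$ (with respect to $M$).
   Context: A matrix dilation $M$ is an integer matrix all of whose eigenvalues are bigger than 1 in modulus; $M^*$ is its conjugate (transpose). A mask is a trigonometric polynomial $m_0(\xi)=\sum_{k\in\mathbb Z^2}h_ke^{2\pi i(k,\xi)}$ (finite sum, $h_k\in\mathbb C$, $\xi\in\mathbb R^2$) with $m_0(\mathbf 0)=1$. The axial symmetry group is $G^{axis}=\{\pm I_2,\pm Y\}$, $Y=\begin{pmatrix}-1&0\\0&1\end{pmatrix}$. A trigonometric polynomial $t$ is axial symmetric with respect to a center $c\in\frac12\mathbb Z^2$ if $t(\xi)=e^{2\pi i(c-Ec,\xi)}t(E^*\xi)$ for all $E\in G^{axis}$. $t$ has sum rule of order $n$ with respect to $M$ if $D^\beta(t(M^{*-1}\xi))|_{\xi=s}=0$ for all $s\in D(M^* )\setminus\{\mathbf 0\}$ and all $\beta\in\mathbb Z^2_+$ with $\beta_1+\beta_2<n$, where $D(M^* )$ is a complete set of representatives of $\mathbb Z^2/M^*\mathbb Z^2$ containing $\mathbf 0$. *)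

theory Defs
  imports "HOL-Analysis.Analysis"
begin

definition eigenvalue :: "complex^'n^'n \<Rightarrow> complex \<Rightarrow> bool" where
  "eigenvalue A \<mu> \<longleftrightarrow> (\<exists>v. v \<noteq> 0 \<and> A *v v = \<mu> *s v)"

definition matrix_dilation :: "int^2^2 \<Rightarrow> bool" where
  "matrix_dilation M \<longleftrightarrow> (\<forall>\<mu>. eigenvalue (map_matrix of_int M) \<mu> \<longrightarrow> norm \<mu> > 1)"

definition real_vec :: "int^2 \<Rightarrow> real^2" where
  "real_vec k = (\<chi> i. real_of_int (k $ i))"

definition trig_poly :: "(real^2 \<Rightarrow> complex) \<Rightarrow> bool" where
  "trig_poly t \<longleftrightarrow> (\<exists>(K :: (int^2) set) h. finite K \<and>
     (\<forall>\<xi>. t \<xi> = (\<Sum>k\<in>K. h k * exp (2 * of_real pi * \<i> * of_real (real_vec k \<bullet> \<xi>)))))"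

definition is_mask :: "(real^2 \<Rightarrow> complex) \<Rightarrow> bool" where
  "is_mask t \<longleftrightarrow> trig_poly t \<and> t 0 = 1"

definition axial_Y :: "real^2^2" where
  "axial_Y = vector [vector [-1, 0], vector [0, 1]]"

definition axial_group :: "(real^2^2) set" where
  "axial_group = {mat 1, - mat 1, axial_Y, - axial_Y}"

definition axial_symmetric :: "real^2 \<Rightarrow> (real^2 \<Rightarrow> complex) \<Rightarrow> bool" where
  "axial_symmetric c t \<longleftrightarrow> (\<forall>i. 2 * c $ i \<in> \<int>) \<and>
     (\<forall>E\<in>axial_group. \<forall>\<xi>.
        t \<xi> = exp (2 * of_real pi * \<i> * of_real ((c - E *v c) \<bullet> \<xi>)) * t (transpose E *v \<xi>))"

definition partial_deriv :: "2 \<Rightarrow> (real^2 \<Rightarrow> complex) \<Rightarrow> real^2 \<Rightarrow> complex" where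
  "partial_deriv i f x = vector_derivative (\<lambda>u. f (x + u *\<^sub>R axis i 1)) (at 0)"

definition multi_deriv :: "nat^2 \<Rightarrow> (real^2 \<Rightarrow> complex) \<Rightarrow> real^2 \<Rightarrow> complex" where
  "multi_deriv \<beta> f = (partial_deriv 1 ^^ (\<beta> $ 1)) ((partial_deriv 2 ^^ (\<beta> $ 2)) f)"

definition complete_representatives :: "int^2^2 \<Rightarrow> (int^2) set \<Rightarrow> bool" where
  "complete_representatives A D \<longleftrightarrow> (\<forall>k. \<exists>!s. s \<in> D \<and> k - s \<in> range (\<lambda>l. A *v l))"

text \<open>
  The usual definition fixes one complete set of representatives \<open>D\<close> of the integer lattice
  modulo its image under \<open>transpose M\<close>, with \<open>0 \<in> D\<close>. Trigonometric polynomials are periodic,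
  so the condition does not depend on that choice, and it is required here for every such
  \<open>D\<close>; the lemma below shows that one exists.
\<close>

definition sum_rule :: "int^2^2 \<Rightarrow> nat \<Rightarrow> (real^2 \<Rightarrow> complex) \<Rightarrow> bool" where
  "sum_rule M n t \<longleftrightarrow>
     (\<forall>D. complete_representatives (transpose M) D \<and> 0 \<in> D \<longrightarrow>
       (\<forall>s\<in>D - {0}. \<forall>\<beta> :: nat^2. \<beta> $ 1 + \<beta> $ 2 < n \<longrightarrow>
          multi_deriv \<beta> (\<lambda>\<xi>. t (matrix_inv (map_matrix real_of_int (transpose M)) *v \<xi>))
            (real_vec s) = 0))"

lemma complete_representatives_exists:
  "\<exists>D. complete_representatives A D \<and> 0 \<in> D"
proof -
  define R where "R k s \<longleftrightarrow> k - s \<in> range (\<lambda>l. A *v l)" for k s :: "int^2"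
  have refl: "R k k" for k
    unfolding R_def by (metis matrix_vector_mult_0_right cancel_comm_monoid_add_class.diff_cancel rangeI)
  have sym: "R s k" if "R k s" for k s
  proof -
    from that obtain l where "k - s = A *v l" by (auto simp: R_def)
    then have "s - k = A *v (0 - l)"
      by (simp only: matrix_vector_mult_diff_distrib matrix_vector_mult_0_right) (simp add: algebra_simps)
    then show ?thesis by (auto simp: R_def)
  qed
  have trans: "R k m" if "R k s" "R s m" for k s m
  proof -
    from that obtain l l' where "k - s = A *v l" "s - m = A *v l'" by (auto simp: R_def)
    then have "k - m = A *v (l + l')"
      by (simp add: matrix_vector_right_distrib algebra_simps)
    then show ?thesis by (auto simp: R_def)
  qed
  define f where "f k = (if R k 0 then 0 else (SOME s. R k s))" for k
  have Rf: "R k (f k)" for k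
    unfolding f_def using someI[of "R k", OF refl] by auto
  have eq: "f k = f s" if "R k s" for k s
  proof -
    have "R k = R s" using that sym trans by blast
    then show ?thesis by (simp add: f_def)
  qed
  have "\<exists>!s. s \<in> range f \<and> R k s" for k
  proof (rule ex1I[of _ "f k"])
    show "f k \<in> range f \<and> R k (f k)" using Rf by blast
    fix s assume s: "s \<in> range f \<and> R k s"
    then obtain j where j: "s = f j" by blast
    then have "R j k" using s Rf[of j] sym trans by blast
    then show "s = f k" using j eq by blast
  qed
  moreover have "0 \<in> range f"
    using refl by (metis f_def rangeI)
  ultimately show ?thesis
    unfolding complete_representatives_def R_def by blast
qed

end

theory Submission
  imports Defs "HOL-Complex_Analysis.Cauchy_Integral_Formula"
begin

text \<open>
  Because \<open>M\<close> is diagonal, a tensor product of univariate masks suffices, and each factor is built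
  from the averages \<open>q\<^sub>g(z) = (1 + e(z) + \<dots> + e(z)\<^bsup>g-1\<^esup>) / g\<close> with \<open>e(z) = exp(2\<pi>iz)\<close>
  (\<open>dirichlet_avg\<close>).  For \<open>g = \<bar>\<gamma>\<bar>\<close> this average is \<open>1\<close> at the origin and vanishes at \<open>s/\<gamma>\<close> for every
  integer \<open>s\<close> that \<open>\<gamma>\<close> does not divide, since \<open>e(s/\<gamma>)\<close> is then a nontrivial \<open>g\<close>-th root of
  unity (\<open>dirichlet_avg_root\<close>).  The product \<open>q\<^sub>g(z) q\<^sub>g(-z)\<close> keeps these zeros and is even, so its
  \<open>n\<close>-th power has zeros of order at least \<open>n\<close> and center of symmetry \<open>0\<close>, whatever the parity of \<open>g\<close>.
  The remaining factor \<open>q\<^sub>2(z) = (1 + e(z))/2\<close> moves the center to \<open>1/2\<close> and preserves the value at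
  the origin as well as the zeros.

  Since \<open>0\<close> represents the class \<open>M\<^sup>*\<int>\<^sup>2\<close>, any other representative \<open>s\<close> lies outside it, so at least one coordinate \<open>s\<^sub>i\<close>
  is not divisible by \<open>\<gamma>\<^sub>i\<close>.  All factors are restrictions of entire functions, hence a mixed
  partial derivative of the tensor product is a product of complex derivatives
  (\<open>multi_deriv_tensor\<close>), one of which is zero.
\<close>

section \<open>Trigonometric polynomials form an algebra\<close>

text \<open>
  Collecting equal frequencies lets them be repeated, which is the form in which sums and
  products of trigonometric polynomials arise.
\<close>

lemma trig_poly_indexed_sum:
  fixes \<kappa> :: "'i \<Rightarrow> int^2" and c :: "'i \<Rightarrow> complex"
  assumes "finite I"
  shows "trig_poly (\<lambda>\<xi>. \<Sum>i\<in>I. c i * exp (2 * of_real pi * \<i> * of_real (real_vec (\<kappa> i) \<bullet> \<xi>)))"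
proof -
  define h where "h k = (\<Sum>i\<in>{i\<in>I. \<kappa> i = k}. c i)" for k
  have "(\<Sum>i\<in>I. c i * exp (2 * of_real pi * \<i> * of_real (real_vec (\<kappa> i) \<bullet> \<xi>)))
      = (\<Sum>k\<in>\<kappa> ` I. h k * exp (2 * of_real pi * \<i> * of_real (real_vec k \<bullet> \<xi>)))" for \<xi>
    by (subst sum.image_gen[OF assms, where g = \<kappa>]) (auto simp: h_def sum_distrib_right intro!: sum.cong)
  then show ?thesis
    unfolding trig_poly_def using assms by blast
qed

lemma trig_poly_monomial:
  "trig_poly (\<lambda>\<xi>. c * exp (2 * of_real pi * \<i> * of_real (real_vec k \<bullet> \<xi>)))"
  using trig_poly_indexed_sum[of "{()}" "\<lambda>_. c" "\<lambda>_. k"] by simp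

lemma trig_poly_const: "trig_poly (\<lambda>_. c)"
  using trig_poly_monomial[of c 0] by (simp add: real_vec_def inner_vec_def)

lemma real_vec_add: "real_vec (k + l) = real_vec k + real_vec l"
  by (simp add: real_vec_def vec_eq_iff)

lemma trig_poly_sum:
  assumes "finite I" and "\<And>i. i \<in> I \<Longrightarrow> trig_poly (t i)"
  shows "trig_poly (\<lambda>\<xi>. \<Sum>i\<in>I. t i \<xi>)"
proof -
  \<comment> \<open>frequencies and coefficients are chosen together, as one pair for each index\<close>
  define rep where "rep i p \<longleftrightarrow> finite (fst p) \<and> (\<forall>\<xi>. t i \<xi> =
      (\<Sum>k\<in>fst p. snd p k * exp (2 * of_real pi * \<i> * of_real (real_vec k \<bullet> \<xi>))))" for i p
  have "\<exists>p. rep i p" if "i \<in> I" for i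
    using assms(2)[OF that] unfolding trig_poly_def rep_def by force
  then obtain p where p: "\<And>i. i \<in> I \<Longrightarrow> rep i (p i)"
    by metis
  define K h where "K i = fst (p i)" and "h i = snd (p i)" for i
  have K: "finite (K i)"
    and t: "t i \<xi> = (\<Sum>k\<in>K i. h i k * exp (2 * of_real pi * \<i> * of_real (real_vec k \<bullet> \<xi>)))"
    if "i \<in> I" for i \<xi>
    using p[OF that] by (auto simp: rep_def K_def h_def)
  have "(\<Sum>i\<in>I. t i \<xi>) = (\<Sum>p\<in>Sigma I K. h (fst p) (snd p) *
      exp (2 * of_real pi * \<i> * of_real (real_vec (snd p) \<bullet> \<xi>)))" for \<xi>
    using assms(1) K by (simp add: t sum.Sigma split_beta)
  then show ?thesis
    using trig_poly_indexed_sum[of "Sigma I K" "\<lambda>p. h (fst p) (snd p)" snd] assms(1) K by simp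
qed

lemma trig_poly_mult:
  assumes "trig_poly t" and "trig_poly u"
  shows "trig_poly (\<lambda>\<xi>. t \<xi> * u \<xi>)"
proof -
  obtain K h where K: "finite K"
    and t: "\<And>\<xi>. t \<xi> = (\<Sum>k\<in>K. h k * exp (2 * of_real pi * \<i> * of_real (real_vec k \<bullet> \<xi>)))"
    using assms(1) unfolding trig_poly_def by blast
  obtain L g where L: "finite L"
    and u: "\<And>\<xi>. u \<xi> = (\<Sum>l\<in>L. g l * exp (2 * of_real pi * \<i> * of_real (real_vec l \<bullet> \<xi>)))"
    using assms(2) unfolding trig_poly_def by blast
  have "t \<xi> * u \<xi> = (\<Sum>p\<in>K \<times> L. (h (fst p) * g (snd p)) *
      exp (2 * of_real pi * \<i> * of_real (real_vec (fst p + snd p) \<bullet> \<xi>)))" for \<xi>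
    unfolding t u sum_product sum.cartesian_product
    by (rule sum.cong) (auto simp: real_vec_add inner_add_left ring_distribs exp_add)
  then show ?thesis
    using trig_poly_indexed_sum[of "K \<times> L" "\<lambda>p. h (fst p) * g (snd p)" "\<lambda>p. fst p + snd p"] K L
    by simp
qed

lemma trig_poly_power:
  assumes "trig_poly t"
  shows "trig_poly (\<lambda>\<xi>. t \<xi> ^ m)"
  by (induction m) (auto intro: trig_poly_const trig_poly_mult assms)

section \<open>The univariate mask\<close>

definition character :: "complex \<Rightarrow> complex" where
  "character z = exp (2 * of_real pi * \<i> * z)"

definition dirichlet_avg :: "nat \<Rightarrow> complex \<Rightarrow> complex" where
  "dirichlet_avg g z = (\<Sum>j<g. character z ^ j) / of_nat g"

text \<open>
  On the real line this is \<open>\<bar>q\<^sub>g(x)\<bar>\<^sup>2\<close>, a normalized Fejer kernel.  The form without absolute value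
  is even and entire.
\<close>

definition fejer_avg :: "nat \<Rightarrow> complex \<Rightarrow> complex" where
  "fejer_avg g z = dirichlet_avg g z * dirichlet_avg g (- z)"

definition half_centered_mask :: "nat \<Rightarrow> nat \<Rightarrow> complex \<Rightarrow> complex" where
  "half_centered_mask g n z = fejer_avg g z ^ n * dirichlet_avg 2 z"

lemma character_0: "character 0 = 1"
  by (simp add: character_def)

lemma character_add: "character (z + w) = character z * character w"
  by (simp add: character_def ring_distribs exp_add)

lemma character_minus: "character (- z) = inverse (character z)"
  by (simp add: character_def exp_minus)

lemma character_nonzero: "character z \<noteq> 0"
  by (simp add: character_def)

lemma half_centered_mask_at_0:
  assumes "g > 0"
  shows "half_centered_mask g n 0 = 1"
  using assms by (simp add: half_centered_mask_def fejer_avg_def dirichlet_avg_def character_0)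

text \<open>
  The Fejer factor is even, so the phase comes from \<open>(1 + e(z))/2\<close> alone.
\<close>

lemma half_centered_mask_symmetric:
  "half_centered_mask g n z = character z * half_centered_mask g n (- z)"
proof -
  have "dirichlet_avg 2 z = character z * dirichlet_avg 2 (- z)"
    using character_nonzero[of z]
    by (simp add: dirichlet_avg_def character_minus numeral_2_eq_2 field_simps)
  then show ?thesis
    by (simp add: half_centered_mask_def fejer_avg_def mult_ac)
qed

lemma holomorphic_dirichlet_avg [holomorphic_intros]:
  assumes "f holomorphic_on S"
  shows "(\<lambda>z. dirichlet_avg g (f z)) holomorphic_on S"
  unfolding dirichlet_avg_def character_def divide_inverse
  by (intro holomorphic_intros assms)

lemma holomorphic_fejer_avg [holomorphic_intros]:
  assumes "f holomorphic_on S"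
  shows "(\<lambda>z. fejer_avg g (f z)) holomorphic_on S"
  unfolding fejer_avg_def by (intro holomorphic_intros assms)

lemma character_power: "character z ^ m = character (of_nat m * z)"
  by (simp add: character_def exp_of_nat_mult[symmetric] mult_ac)

lemma character_eq_1_iff: "character z = 1 \<longleftrightarrow> z \<in> \<int>"
proof -
  have "character z = 1 \<longleftrightarrow> (\<exists>k::int. z = of_int k)"
    unfolding character_def exp_eq_1
    by (auto simp: complex_eq_iff)
  then show ?thesis by (auto simp: Ints_def)
qed

lemma dirichlet_avg_root:
  assumes "z \<notin> \<int>" and "of_nat g * z \<in> \<int>"
  shows "dirichlet_avg g z = 0"
proof -
  have "character z \<noteq> 1" "character z ^ g = 1"
    using assms by (auto simp: character_eq_1_iff character_power)
  then show ?thesis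
    by (simp add: dirichlet_avg_def geometric_sum)
qed

lemma fejer_avg_root:
  fixes \<gamma> s :: int
  assumes "\<gamma> \<noteq> 0" and "\<not> \<gamma> dvd s"
  shows "fejer_avg (nat \<bar>\<gamma>\<bar>) (of_int s / of_int \<gamma>) = 0"
proof -
  have "(of_int s / of_int \<gamma> :: complex) \<notin> \<int>"
  proof
    assume "(of_int s / of_int \<gamma> :: complex) \<in> \<int>"
    then obtain k where "(of_int s / of_int \<gamma> :: complex) = of_int k" by (auto elim: Ints_cases)
    then have "(of_int s :: complex) = of_int (\<gamma> * k)"
      using assms(1) by (simp add: field_simps)
    then have "s = \<gamma> * k" by (simp only: of_int_eq_iff)
    with assms(2) show False by simp
  qed
  \<comment> \<open>for negative \<open>\<gamma>\<close> the quotient has denominator \<open>-\<bar>\<gamma>\<bar>\<close>, which costs only a sign\<close>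
  moreover have "of_nat (nat \<bar>\<gamma>\<bar>) * (of_int s / of_int \<gamma> :: complex) = of_int (sgn \<gamma> * s)"
    using assms(1) by (cases "\<gamma> > 0") (auto simp: sgn_if)
  ultimately have "dirichlet_avg (nat \<bar>\<gamma>\<bar>) (of_int s / of_int \<gamma>) = 0"
    by (metis dirichlet_avg_root Ints_of_int)
  then show ?thesis by (simp add: fejer_avg_def)
qed

text \<open>
  Both factors of \<open>fejer_avg\<close> are needed as functions on the plane: \<open>\<sigma> = 1\<close> gives the first one
  and \<open>\<sigma> = -1\<close> the reflected one.
\<close>

lemma trig_poly_dirichlet_avg:
  fixes \<sigma> :: int
  shows "trig_poly (\<lambda>\<xi>. dirichlet_avg g (of_int \<sigma> * of_real (\<xi> $ i)))"
proof -
  have mono: "character (of_int \<sigma> * of_real (\<xi> $ i)) ^ j =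
      exp (2 * of_real pi * \<i> * of_real (real_vec (axis i (int j * \<sigma>)) \<bullet> \<xi>))"
    for \<xi> :: "real^2" and j
  proof -
    have "real_vec (axis i (int j * \<sigma>)) = axis i (real j * of_int \<sigma>)"
      by (simp add: real_vec_def axis_def vec_eq_iff)
    then show ?thesis
      unfolding character_power by (simp add: inner_axis' character_def mult_ac)
  qed
  show ?thesis
    unfolding dirichlet_avg_def sum_divide_distrib
    unfolding mono divide_inverse
    by (subst mult.commute, intro trig_poly_sum finite_lessThan trig_poly_monomial)
qed

lemma trig_poly_half_centered_mask:
  "trig_poly (\<lambda>\<xi>. half_centered_mask g n (of_real (\<xi> $ i)))"
proof -
  have "trig_poly (\<lambda>\<xi>. dirichlet_avg m (of_real (\<xi> $ i)))" for m
    using trig_poly_dirichlet_avg[of m 1 i] by simp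
  moreover have "trig_poly (\<lambda>\<xi>. dirichlet_avg m (- of_real (\<xi> $ i)))" for m
    using trig_poly_dirichlet_avg[of m "-1" i] by simp
  ultimately show ?thesis
    unfolding half_centered_mask_def fejer_avg_def
    by (intro trig_poly_mult trig_poly_power)
qed

section \<open>Derivatives of tensor products\<close>

lemma vector_derivative_along_reals:
  fixes A :: "complex \<Rightarrow> complex"
  assumes "A holomorphic_on UNIV"
  shows "((\<lambda>u. A (of_real (x + u))) has_vector_derivative deriv A (of_real x)) (at 0)"
proof -
  have "(A has_field_derivative deriv A (of_real x)) (at (of_real (x + 0)))"
    using assms by (simp add: holomorphic_derivI)
  moreover have "((\<lambda>u. complex_of_real (x + u)) has_vector_derivative 1) (at 0)"
    by (auto intro!: derivative_eq_intros)
  ultimately show ?thesis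
    using field_vector_diff_chain_at[of "\<lambda>u. complex_of_real (x + u)" 1 0 A]
    by (simp add: o_def)
qed

lemma partial_deriv_tensor:
  assumes "A holomorphic_on UNIV" and "B holomorphic_on UNIV"
  shows "partial_deriv 1 (\<lambda>\<xi>. A (of_real (\<xi> $ 1)) * B (of_real (\<xi> $ 2))) =
      (\<lambda>\<xi>. deriv A (of_real (\<xi> $ 1)) * B (of_real (\<xi> $ 2)))"
    and "partial_deriv 2 (\<lambda>\<xi>. A (of_real (\<xi> $ 1)) * B (of_real (\<xi> $ 2))) =
      (\<lambda>\<xi>. A (of_real (\<xi> $ 1)) * deriv B (of_real (\<xi> $ 2)))"
proof -
  have *: "(axis 1 1 :: real^2) $ 2 = 0" "(axis 2 1 :: real^2) $ 1 = 0"
    by (simp_all add: axis_def)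
  show "partial_deriv 1 (\<lambda>\<xi>. A (of_real (\<xi> $ 1)) * B (of_real (\<xi> $ 2))) =
      (\<lambda>\<xi>. deriv A (of_real (\<xi> $ 1)) * B (of_real (\<xi> $ 2)))"
    unfolding partial_deriv_def
    using vector_derivative_along_reals[OF assms(1)]
    by (intro ext vector_derivative_at) (auto simp: * intro!: has_vector_derivative_mult_left simp del: of_real_add)
  show "partial_deriv 2 (\<lambda>\<xi>. A (of_real (\<xi> $ 1)) * B (of_real (\<xi> $ 2))) =
      (\<lambda>\<xi>. A (of_real (\<xi> $ 1)) * deriv B (of_real (\<xi> $ 2)))"
    unfolding partial_deriv_def
    using vector_derivative_along_reals[OF assms(2)]
    by (intro ext vector_derivative_at) (auto simp: * intro!: has_vector_derivative_mult_right simp del: of_real_add)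
qed

lemma multi_deriv_tensor:
  assumes A: "A holomorphic_on UNIV" and B: "B holomorphic_on UNIV"
  shows "multi_deriv \<beta> (\<lambda>\<xi>. A (of_real (\<xi> $ 1)) * B (of_real (\<xi> $ 2))) =
    (\<lambda>\<xi>. (deriv ^^ (\<beta> $ 1)) A (of_real (\<xi> $ 1)) * (deriv ^^ (\<beta> $ 2)) B (of_real (\<xi> $ 2)))"
proof -
  have hol: "(deriv ^^ m) f holomorphic_on UNIV" if "f holomorphic_on UNIV" for f and m :: nat
    using that by (simp add: holomorphic_higher_deriv)
  have b: "(partial_deriv 2 ^^ b) (\<lambda>\<xi>. A (of_real (\<xi> $ 1)) * B (of_real (\<xi> $ 2))) =
     (\<lambda>\<xi>. A (of_real (\<xi> $ 1)) * (deriv ^^ b) B (of_real (\<xi> $ 2)))" for b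
    by (induction b) (simp_all add: partial_deriv_tensor A hol[OF B])
  have a: "(partial_deriv 1 ^^ a) (\<lambda>\<xi>. A (of_real (\<xi> $ 1)) * C (of_real (\<xi> $ 2))) =
     (\<lambda>\<xi>. (deriv ^^ a) A (of_real (\<xi> $ 1)) * C (of_real (\<xi> $ 2)))"
    if "C holomorphic_on UNIV" for a C
    by (induction a) (simp_all add: partial_deriv_tensor that hol[OF A])
  show ?thesis
    unfolding multi_deriv_def b using a[OF hol[OF B]] by simp
qed

text \<open>
  Differentiation lowers the exponent of \<open>u\<close> by at most one, and the cofactor stays entire.
\<close>

lemma higher_deriv_power_mult_eq_0:
  fixes u v :: "complex \<Rightarrow> complex"
  assumes u: "u holomorphic_on UNIV" and "v holomorphic_on UNIV" and "u z\<^sub>0 = 0" and "k < n"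
  shows "(deriv ^^ k) (\<lambda>z. u z ^ n * v z) z\<^sub>0 = 0"
  using assms(2,4)
proof (induction k arbitrary: n v)
  case 0
  then show ?case using \<open>u z\<^sub>0 = 0\<close> by simp
next
  case (Suc k)
  then obtain m where n: "n = Suc m" and m: "k < m" by (cases n) auto
  define w where "w z = of_nat n * deriv u z * v z + u z * deriv v z" for z
  have w: "w holomorphic_on UNIV"
    unfolding w_def using u Suc.prems(1)
    by (intro holomorphic_intros holomorphic_deriv) auto
  have "deriv (\<lambda>z. u z ^ n * v z) = (\<lambda>z. u z ^ m * w z)"
  proof
    fix z
    have "(u has_field_derivative deriv u z) (at z)" "(v has_field_derivative deriv v z) (at z)"
      using u Suc.prems(1) by (simp_all add: holomorphic_derivI)
    moreover have "u z * u z ^ (m - Suc 0) = u z ^ m"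
      using m by (simp add: power_eq_if)
    ultimately have "((\<lambda>z. u z ^ n * v z) has_field_derivative u z ^ m * w z) (at z)"
      unfolding w_def by (auto intro!: derivative_eq_intros simp: n algebra_simps)
    then show "deriv (\<lambda>z. u z ^ n * v z) z = u z ^ m * w z" by (rule DERIV_imp_deriv)
  qed
  then have "(deriv ^^ Suc k) (\<lambda>z. u z ^ n * v z) = (deriv ^^ k) (\<lambda>z. u z ^ m * w z)"
    by (simp add: funpow_Suc_right del: funpow.simps)
  then show ?case using Suc.IH[OF w m] by simp
qed

lemma holomorphic_half_centered_mask_scaled:
  "(\<lambda>z. half_centered_mask g n (z / c)) holomorphic_on UNIV"
  unfolding half_centered_mask_def divide_inverse by (intro holomorphic_intros)

lemma half_centered_mask_vanishing_order:
  fixes \<gamma> s :: int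
  assumes "\<gamma> \<noteq> 0" and "\<not> \<gamma> dvd s" and "k < n"
  shows "(deriv ^^ k) (\<lambda>z. half_centered_mask (nat \<bar>\<gamma>\<bar>) n (z / of_int \<gamma>)) (of_int s) = 0"
  unfolding half_centered_mask_def
proof (rule higher_deriv_power_mult_eq_0)
  show "(\<lambda>z. fejer_avg (nat \<bar>\<gamma>\<bar>) (z / of_int \<gamma>)) holomorphic_on UNIV"
    "(\<lambda>z. dirichlet_avg 2 (z / of_int \<gamma>)) holomorphic_on UNIV"
    unfolding divide_inverse by (intro holomorphic_intros)+
qed (use assms fejer_avg_root in auto)

section \<open>Diagonal dilations\<close>

lemma diagonal_matrix_vector_mult:
  fixes a b :: "'a::comm_ring_1" and x :: "'a^2"
  shows "vector [vector [a, 0], vector [0, b]] *v x = (vector [a * x $ 1, b * x $ 2] :: 'a^2)"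
  by (simp add: vec_eq_iff forall_2 matrix_vector_mult_def sum_2)

lemma transpose_diagonal:
  "transpose (vector [vector [a, 0], vector [0, b]]) =
    (vector [vector [a, 0], vector [0, b]] :: 'a::zero^2^2)"
  by (simp add: vec_eq_iff forall_2 transpose_def)

lemma map_matrix_diagonal:
  "map_matrix of_int (vector [vector [a, 0], vector [0, b]]) =
    (vector [vector [of_int a, 0], vector [0, of_int b]] :: 'a::ring_1^2^2)"
  by (simp add: vec_eq_iff forall_2 map_matrix_def)

lemma diagonal_dilation_nonzero:
  assumes "matrix_dilation (vector [vector [\<gamma>1, 0], vector [0, \<gamma>2]])"
  shows "\<gamma>1 \<noteq> 0" and "\<gamma>2 \<noteq> 0"
proof -
  let ?A = "map_matrix of_int (vector [vector [\<gamma>1, 0], vector [0, \<gamma>2]]) :: complex^2^2"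
  have "eigenvalue ?A (of_int \<gamma>1)"
    unfolding eigenvalue_def map_matrix_diagonal diagonal_matrix_vector_mult
    by (rule exI[of _ "vector [1, 0]"]) (simp add: vec_eq_iff forall_2)
  moreover have "eigenvalue ?A (of_int \<gamma>2)"
    unfolding eigenvalue_def map_matrix_diagonal diagonal_matrix_vector_mult
    by (rule exI[of _ "vector [0, 1]"]) (simp add: vec_eq_iff forall_2)
  ultimately show "\<gamma>1 \<noteq> 0" "\<gamma>2 \<noteq> 0"
    using assms unfolding matrix_dilation_def by force+
qed

lemma matrix_inv_eqI:
  fixes A :: "'a::semiring_1^'n^'n"
  assumes "A ** B = mat 1" and "B ** A = mat 1"
  shows "matrix_inv A = B"
proof -
  have "matrix_inv A ** A = mat 1"
    unfolding matrix_inv_def using someI[of "\<lambda>A'. A ** A' = mat 1 \<and> A' ** A = mat 1" B] assms by blast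
  then have "matrix_inv A ** (A ** B) = B" by (simp add: matrix_mul_assoc)
  then show ?thesis by (simp add: assms(1))
qed

lemma matrix_inv_diagonal_mult:
  fixes a b :: real and \<xi> :: "real^2"
  assumes "a \<noteq> 0" and "b \<noteq> 0"
  shows "matrix_inv (vector [vector [a, 0], vector [0, b]]) *v \<xi> =
    (vector [\<xi> $ 1 / a, \<xi> $ 2 / b] :: real^2)"
proof -
  let ?A = "vector [vector [a, 0], vector [0, b]] :: real^2^2"
  let ?B = "vector [vector [1 / a, 0], vector [0, 1 / b]] :: real^2^2"
  have "?A ** ?B = mat 1" "?B ** ?A = mat 1"
    using assms by (simp_all add: vec_eq_iff forall_2 matrix_matrix_mult_def sum_2 mat_def)
  then have "matrix_inv ?A = ?B" by (rule matrix_inv_eqI)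
  then show ?thesis by (simp add: diagonal_matrix_vector_mult)
qed

text \<open>
  If both entries were divisible, \<open>s\<close> and \<open>0\<close> would be two representatives of one class.
\<close>

lemma representative_not_divisible:
  assumes "complete_representatives (vector [vector [a, 0], vector [0, b]]) D"
    and "0 \<in> D" and "s \<in> D" and "s \<noteq> 0"
  shows "\<not> a dvd s $ 1 \<or> \<not> b dvd s $ 2"
proof (rule ccontr)
  let ?A = "vector [vector [a, 0], vector [0, b]] :: int^2^2"
  assume "\<not> ?thesis"
  then obtain x y where "s $ 1 = a * x" "s $ 2 = b * y" by (auto elim!: dvdE)
  then have "s - 0 = ?A *v vector [x, y]"
    by (simp add: diagonal_matrix_vector_mult vec_eq_iff forall_2)
  then have "s - 0 \<in> range (\<lambda>l. ?A *v l)" by blast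
  moreover have "s - s \<in> range (\<lambda>l. ?A *v l)"
    by (rule range_eqI[of _ _ 0]) simp
  ultimately show False
    using assms unfolding complete_representatives_def by metis
qed

text \<open>
  For the center \<open>c = (1/2, 1/2)\<close> the entry of \<open>c - Ec\<close> is \<open>1\<close> at a coordinate that \<open>E\<close> reflects
  and \<open>0\<close> at one that it fixes.  The phase is therefore the product of the univariate phases of
  the reflected coordinates.
\<close>

lemma axial_symmetric_tensor:
  assumes a: "\<And>x. a x = character (of_real x) * a (- x)"
    and b: "\<And>x. b x = character (of_real x) * b (- x)"
  shows "axial_symmetric (vector [1/2, 1/2]) (\<lambda>\<xi>. a (\<xi> $ 1) * b (\<xi> $ 2))"
proof -
  let ?c = "vector [1/2, 1/2] :: real^2"
  have Y: "axial_Y $ 1 $ 1 = -1" "axial_Y $ 1 $ 2 = 0" "axial_Y $ 2 $ 1 = 0" "axial_Y $ 2 $ 2 = 1"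
    by (simp_all add: axial_Y_def)
  have half: "2 * ?c $ i \<in> \<int>" for i
    using exhaust_2[of i] by auto
  have E: "a (\<xi> $ 1) * b (\<xi> $ 2) = exp (2 * of_real pi * \<i> * of_real ((?c - E *v ?c) \<bullet> \<xi>)) *
        (a ((transpose E *v \<xi>) $ 1) * b ((transpose E *v \<xi>) $ 2))"
    if "E \<in> axial_group" for E \<xi>
    using that a[of "\<xi> $ 1"] b[of "\<xi> $ 2"]
    unfolding character_def[symmetric]
    by (auto simp: axial_group_def inner_vec_def sum_2 matrix_vector_mult_def transpose_def mat_def Y
        character_add character_0)
  show ?thesis
    unfolding axial_symmetric_def
    by (intro conjI ballI allI E half)
qed

theorem theorem27:
  fixes \<gamma>1 \<gamma>2 :: int and M :: "int^2^2" and n :: nat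
  assumes "M = vector [vector [\<gamma>1, 0], vector [0, \<gamma>2]]"
    and "matrix_dilation M"
  shows "\<exists>m0. is_mask m0 \<and> axial_symmetric (vector [1/2, 1/2]) m0 \<and> sum_rule M n m0"
proof -
  have nz: "\<gamma>1 \<noteq> 0" "\<gamma>2 \<noteq> 0"
    using diagonal_dilation_nonzero assms by auto
  define P where "P \<gamma> = half_centered_mask (nat \<bar>\<gamma>\<bar>) n" for \<gamma> :: int
  define m0 where "m0 \<xi> = P \<gamma>1 (of_real (\<xi> $ 1)) * P \<gamma>2 (of_real (\<xi> $ 2))" for \<xi> :: "real^2"
  have "is_mask m0"
    unfolding is_mask_def m0_def P_def using nz
    by (auto intro: trig_poly_mult trig_poly_half_centered_mask simp: half_centered_mask_at_0)
  moreover have "axial_symmetric (vector [1/2, 1/2]) m0"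
    unfolding m0_def P_def using half_centered_mask_symmetric
    by (intro axial_symmetric_tensor) (metis of_real_minus)+
  moreover have "sum_rule M n m0"
    unfolding sum_rule_def
  proof (intro allI impI ballI)
    fix D s and \<beta> :: "nat^2"
    assume D: "complete_representatives (transpose M) D \<and> 0 \<in> D" and s: "s \<in> D - {0}"
      and \<beta>: "\<beta> $ 1 + \<beta> $ 2 < n"
    have nd: "\<not> \<gamma>1 dvd s $ 1 \<or> \<not> \<gamma>2 dvd s $ 2"
      using D s representative_not_divisible unfolding assms(1) transpose_diagonal by blast
    have "(\<lambda>\<xi>. m0 (matrix_inv (map_matrix real_of_int (transpose M)) *v \<xi>)) =
      (\<lambda>\<xi>. P \<gamma>1 (of_real (\<xi> $ 1) / of_int \<gamma>1) * P \<gamma>2 (of_real (\<xi> $ 2) / of_int \<gamma>2))"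
      using nz by (simp add: assms(1) transpose_diagonal map_matrix_diagonal
          matrix_inv_diagonal_mult m0_def)
    moreover have "multi_deriv \<beta>
        (\<lambda>\<xi>. P \<gamma>1 (of_real (\<xi> $ 1) / of_int \<gamma>1) * P \<gamma>2 (of_real (\<xi> $ 2) / of_int \<gamma>2)) (real_vec s) =
      (deriv ^^ (\<beta> $ 1)) (\<lambda>z. P \<gamma>1 (z / of_int \<gamma>1)) (of_int (s $ 1)) *
      (deriv ^^ (\<beta> $ 2)) (\<lambda>z. P \<gamma>2 (z / of_int \<gamma>2)) (of_int (s $ 2))"
      using multi_deriv_tensor[of "\<lambda>z. P \<gamma>1 (z / of_int \<gamma>1)" "\<lambda>z. P \<gamma>2 (z / of_int \<gamma>2)" \<beta>]
      by (simp add: P_def holomorphic_half_centered_mask_scaled real_vec_def)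
    moreover have "\<dots> = 0"
      unfolding P_def using nd \<beta> nz half_centered_mask_vanishing_order by auto
    ultimately show "multi_deriv \<beta>
        (\<lambda>\<xi>. m0 (matrix_inv (map_matrix real_of_int (transpose M)) *v \<xi>)) (real_vec s) = 0"
      by simp
  qed
  ultimately show ?thesis by blast
qed

end
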